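(* Let $G(V,E,W)$ be a limited-flow network with $n$ nodes, $m$ arcs and $p$ minimal cuts $C_1,\dots,C_p$, and let $d$ be a positive integer. Let $\sigma\ge 1$ bound, for each $i$, the number of non-negative integer solutions $X$ (the $d$-MC candidates generated from $C_i$) of the system $\sum_{e\in C_i}X(e)=d$, $X(e)\le W(e)$ for $e\in C_i$, $X(e)=W(e)$ for $e\notin C_i$. Then the time complexity of the algorithm described in the context for finding all the $d$-MCs of $G(V,E,W)$, under the cost conventions stated there, is $O\big((m^2+n^2\sqrt{m})\,p\,\sigma\big)$.
   Context: A limited-flow (stochastic-flow) network $G(V,E,W)$ has nodes $V=\{1,\dots,n\}$, source $1$, sink $n$, edges (arcs) $E=\{e_1,\dots,e_m\}$ and non-negative integer max-capacities $W(e_i)$. A system-state vector $X$ assigns to each $e\in E$ an integer current capacity $0\le X(e)\le W(e)$; $G(V,E,X)$ is the network with these capacities, and $W(X)$ is its maximum flow value from node $1$ to node $n$. $0(e_i)$ is the vector with entry $1$ at $e_i$ and $0$ elsewhere. $U(X)=\{e_i : X(e_i)<W(e_i)\}$. A minimal cut (MC) is an inclusion-minimal set of edges whose removal leaves no path from node $1$ to node $n$. $X$ is a $d$-MC if and only if $W(X)=d$ and $W(X+0(e_i))>d$ for every $e_i\in U(X)$. For $Y$ with $W(Y)\ge d$, $R(V,E,Y)$ is the residual network of $G(V,E,Y)$ after sending $d$ units of flow from node $1$ to node $n$. Algorithm. Input: all MCs $C_1,\dots,C_p$ of $G(V,E,W)$. Output: all $d$-MCs. STEP 1: Let $i=j=1$.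 STEP 2: By implicit enumeration find a (next) feasible solution $X$ in non-negative integers of: $\sum_{e\in C_i}X(e)=d$; $X(e)\le W(e)$ for all $e\in C_i$; $X(e)=W(e)$ for all $e\notin C_i$. If no such (further) solution exists, go to STEP 8. STEP 3: If $X$ is the first feasible solution generated from $C_i$ in STEP 2, run a max-flow algorithm to find $W(X)$. Otherwise, find $W(X)$ from a known relation between candidates when that relation applies, and by a max-flow algorithm when it does not; the relation need not apply to any two given candidates, so in the worst case the max-flow algorithm is run for every solution. STEP 4: If $W(X)\ne d$, return to STEP 2 to find the next feasible solution. Otherwise let $C^d_{ij}=X$, $j\leftarrow j+1$, $k=1$ (the vector just stored is the one tested in STEPS 5-7). STEP 5: If $C^d_{ij}(e_k)=W(e_k)$, go to STEP 7. STEP 6: If there is no path from node $1$ to node $n$ through $e_k$ in $R(V,E,C^d_{ij}+0(e_k))$, then $C^d_{ij}$ is not a $d$-MC; return to STEP 2 to find the next feasible solution. Otherwise go to STEP 7. STEP 7: If $k<m$, then $k\leftarrow k+1$ and go to STEP 5. Otherwise $C^d_{ij}$ is a $d$-MC; return to STEP 2 to find the next feasible solution. STEP 8: If $i<p$, then $i\leftarrow i+1$, $j=1$ and go to STEP 2. Otherwise halt. Cost conventions: the cost of solving the system in STEP 2 is disregarded; finding $W(X)$ in STEP 3 for one solution $X$ costs at most one run of the max-flow algorithm, which takes $O(n^2\sqrt{m})$ time; one search for a path from the source to the sink in STEP 6 takes $O(m)$ time; each single execution of STEPS 1, 4, 5, 7, 8 takes $O(1)$ time. *)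

theory Defs
  imports Complex_Main "HOL-Library.FuncSet" "Graph_Theory.Digraph" "Graph_Theory.Arc_Walk"
begin

text \<open>
  Networks are directed multigraphs on the nodes \<open>1, ..., n\<close> with source \<open>1\<close> and sink \<open>n\<close>.
  The arc \<open>e\<^sub>k\<close> is represented by its index \<open>k\<close>, so the arc set is \<open>{1..m}\<close>.
\<close>

definition limited_flow_network :: "(nat, nat) pre_digraph \<Rightarrow> nat \<Rightarrow> nat \<Rightarrow> bool" where
  "limited_flow_network G n m \<longleftrightarrow>
     wf_digraph G \<and> verts G = {1..n} \<and> arcs G = {1..m} \<and> 2 \<le> n \<and> 1 \<le> m"

text \<open>
  Capacity vectors, and the maximal capacities \<open>W\<close>, are functions on arcs; only their values on
  \<open>arcs G\<close> matter.
\<close>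

type_synonym cap_vec = "nat \<Rightarrow> nat"

definition add_unit :: "cap_vec \<Rightarrow> nat \<Rightarrow> cap_vec" where
  "add_unit X e = (\<lambda>a. X a + (if a = e then 1 else 0))"

definition is_flow :: "(nat, nat) pre_digraph \<Rightarrow> nat \<Rightarrow> cap_vec \<Rightarrow> (nat \<Rightarrow> nat) \<Rightarrow> bool" where
  "is_flow G n X f \<longleftrightarrow>
     (\<forall>e\<in>arcs G. f e \<le> X e) \<and>
     (\<forall>v\<in>verts G - {1, n}. sum f (in_arcs G v) = sum f (out_arcs G v))"

definition flow_value :: "(nat, nat) pre_digraph \<Rightarrow> (nat \<Rightarrow> nat) \<Rightarrow> int" where
  "flow_value G f = int (sum f (out_arcs G 1)) - int (sum f (in_arcs G 1))"

definition max_flow :: "(nat, nat) pre_digraph \<Rightarrow> nat \<Rightarrow> cap_vec \<Rightarrow> int" where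
  "max_flow G n X = Max {flow_value G f |f. is_flow G n X f}"

definition is_cut :: "(nat, nat) pre_digraph \<Rightarrow> nat \<Rightarrow> nat set \<Rightarrow> bool" where
  "is_cut G n C \<longleftrightarrow>
     C \<subseteq> arcs G \<and> \<not> (\<exists>p. pre_digraph.apath (G\<lparr>arcs := arcs G - C\<rparr>) 1 p n)"

definition minimal_cut :: "(nat, nat) pre_digraph \<Rightarrow> nat \<Rightarrow> nat set \<Rightarrow> bool" where
  "minimal_cut G n C \<longleftrightarrow> is_cut G n C \<and> (\<forall>C'. C' \<subset> C \<longrightarrow> \<not> is_cut G n C')"

definition lists_minimal_cuts :: "(nat, nat) pre_digraph \<Rightarrow> nat \<Rightarrow> nat set list \<Rightarrow> bool" where
  "lists_minimal_cuts G n Cs \<longleftrightarrow> distinct Cs \<and> set Cs = {C. minimal_cut G n C}"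

text \<open>
  The residual network of \<open>G(V,E,Y)\<close> with respect to a flow \<open>f\<close>: \<open>(e, True)\<close> is the arc \<open>e\<close>
  itself, with residual capacity \<open>Y e - f e\<close>, and \<open>(e, False)\<close> is its reversal, with residual
  capacity \<open>f e\<close>; arcs of residual capacity \<open>0\<close> are absent.
\<close>

definition residual ::
  "(nat, nat) pre_digraph \<Rightarrow> cap_vec \<Rightarrow> (nat \<Rightarrow> nat) \<Rightarrow> (nat, nat \<times> bool) pre_digraph" where
  "residual G Y f =
     \<lparr>verts = verts G,
      arcs = {(e, True) |e. e \<in> arcs G \<and> f e < Y e} \<union> {(e, False) |e. e \<in> arcs G \<and> 0 < f e},
      tail = (\<lambda>(e, fwd). if fwd then tail G e else head G e),
      head = (\<lambda>(e, fwd). if fwd then head G e else tail G e)\<rparr>"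

definition residual_path_through ::
  "(nat, nat) pre_digraph \<Rightarrow> nat \<Rightarrow> cap_vec \<Rightarrow> (nat \<Rightarrow> nat) \<Rightarrow> nat \<Rightarrow> bool" where
  "residual_path_through G n Y f e \<longleftrightarrow>
     (\<exists>p. pre_digraph.apath (residual G Y f) 1 p n \<and> (e, True) \<in> set p)"

text \<open>
  Vectors are taken extensional on \<open>arcs G\<close>, so that each solution of the system is counted once.
\<close>

definition candidates ::
  "(nat, nat) pre_digraph \<Rightarrow> cap_vec \<Rightarrow> nat \<Rightarrow> nat set \<Rightarrow> cap_vec set" where
  "candidates G W d C =
     {X \<in> arcs G \<rightarrow>\<^sub>E UNIV.
        sum X C = d \<and> (\<forall>e\<in>C. X e \<le> W e) \<and> (\<forall>e\<in>arcs G - C. X e = W e)}"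

text \<open>
  The algorithm is a transition system whose control points are its steps. In a state, \<open>seen\<close> is
  the set of solutions generated so far from the current minimal cut, \<open>val\<close> is the maximum flow
  value determined in \<open>Step3\<close>, \<open>stored (i, j)\<close> is the vector \<open>C\<^sup>d\<^sub>i\<^sub>j\<close>, and \<open>found\<close> collects
  the vectors declared to be \<open>d\<close>-MCs. The vector tested in \<open>Step5\<close> to \<open>Step7\<close> is \<open>cur\<close>, which is
  the vector stored last.
\<close>

datatype label = Step1 | Step2 | Step3 | Step4 | Step5 | Step6 | Step7 | Step8 | Halted

record state =
  pc :: label
  idx_i :: nat
  idx_j :: nat
  idx_k :: nat
  cur :: cap_vec
  val :: int
  seen :: "cap_vec set"
  stored :: "nat \<times> nat \<Rightarrow> cap_vec option"
  found :: "cap_vec set"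

definition is_initial :: "state \<Rightarrow> bool" where
  "is_initial s \<longleftrightarrow> pc s = Step1 \<and> stored s = Map.empty \<and> found s = {}"

text \<open>
  \<open>alg_step ... s t s'\<close>: from state \<open>s\<close> one step of cost \<open>t\<close> leads to \<open>s'\<close>. The numbers \<open>a\<close>, \<open>b\<close>,
  \<open>c\<close> are the constants hidden in the cost conventions: a run of the max-flow algorithm costs at
  most \<open>a * n\<^sup>2 * sqrt m\<close>, a path search at most \<open>b * m\<close>, and a single execution of any other
  step at most \<open>c\<close>, except that \<open>Step2\<close> is free. The relation is nondeterministic in the order in
  which solutions are generated, in the \<open>d\<close> units of flow that are sent in \<open>Step6\<close>, and in the
  costs. \<open>Step3\<close> needs a single rule, as both ways of finding the maximum flow value
  cost at most one run of the max-flow algorithm.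
\<close>

inductive alg_step ::
  "(nat, nat) pre_digraph \<Rightarrow> nat \<Rightarrow> nat \<Rightarrow> cap_vec \<Rightarrow> nat \<Rightarrow> nat set list \<Rightarrow>
   real \<Rightarrow> real \<Rightarrow> real \<Rightarrow> state \<Rightarrow> real \<Rightarrow> state \<Rightarrow> bool"
  for G n m W d Cs a b c
where
  step1:
    "\<lbrakk>pc s = Step1; 0 \<le> t; t \<le> c\<rbrakk> \<Longrightarrow>
     alg_step G n m W d Cs a b c s t (s\<lparr>pc := Step2, idx_i := 1, idx_j := 1, seen := {}\<rparr>)"
| step2_next:
    "\<lbrakk>pc s = Step2; X \<in> candidates G W d (Cs ! (idx_i s - 1)); X \<notin> seen s\<rbrakk> \<Longrightarrow>
     alg_step G n m W d Cs a b c s 0 (s\<lparr>pc := Step3, cur := X, seen := insert X (seen s)\<rparr>)"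
| step2_none:
    "\<lbrakk>pc s = Step2; candidates G W d (Cs ! (idx_i s - 1)) \<subseteq> seen s\<rbrakk> \<Longrightarrow>
     alg_step G n m W d Cs a b c s 0 (s\<lparr>pc := Step8\<rparr>)"
| step3:
    "\<lbrakk>pc s = Step3; 0 \<le> t; t \<le> a * ((real n)\<^sup>2 * sqrt (real m))\<rbrakk> \<Longrightarrow>
     alg_step G n m W d Cs a b c s t (s\<lparr>pc := Step4, val := max_flow G n (cur s)\<rparr>)"
| step4_reject:
    "\<lbrakk>pc s = Step4; val s \<noteq> int d; 0 \<le> t; t \<le> c\<rbrakk> \<Longrightarrow>
     alg_step G n m W d Cs a b c s t (s\<lparr>pc := Step2\<rparr>)"
| step4_store:
    "\<lbrakk>pc s = Step4; val s = int d; 0 \<le> t; t \<le> c\<rbrakk> \<Longrightarrow>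
     alg_step G n m W d Cs a b c s t
       (s\<lparr>pc := Step5, stored := (stored s)((idx_i s, idx_j s) \<mapsto> cur s),
          idx_j := idx_j s + 1, idx_k := 1\<rparr>)"
| step5_saturated:
    "\<lbrakk>pc s = Step5; cur s (idx_k s) = W (idx_k s); 0 \<le> t; t \<le> c\<rbrakk> \<Longrightarrow>
     alg_step G n m W d Cs a b c s t (s\<lparr>pc := Step7\<rparr>)"
| step5_unsaturated:
    "\<lbrakk>pc s = Step5; cur s (idx_k s) \<noteq> W (idx_k s); 0 \<le> t; t \<le> c\<rbrakk> \<Longrightarrow>
     alg_step G n m W d Cs a b c s t (s\<lparr>pc := Step6\<rparr>)"
| step6_reject:
    "\<lbrakk>pc s = Step6; Y = add_unit (cur s) (idx_k s); is_flow G n Y f; flow_value G f = int d;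
      \<not> residual_path_through G n Y f (idx_k s); 0 \<le> t; t \<le> b * real m\<rbrakk> \<Longrightarrow>
     alg_step G n m W d Cs a b c s t (s\<lparr>pc := Step2\<rparr>)"
| step6_pass:
    "\<lbrakk>pc s = Step6; Y = add_unit (cur s) (idx_k s); is_flow G n Y f; flow_value G f = int d;
      residual_path_through G n Y f (idx_k s); 0 \<le> t; t \<le> b * real m\<rbrakk> \<Longrightarrow>
     alg_step G n m W d Cs a b c s t (s\<lparr>pc := Step7\<rparr>)"
| step7_next:
    "\<lbrakk>pc s = Step7; idx_k s < m; 0 \<le> t; t \<le> c\<rbrakk> \<Longrightarrow>
     alg_step G n m W d Cs a b c s t (s\<lparr>pc := Step5, idx_k := idx_k s + 1\<rparr>)"
| step7_accept:
    "\<lbrakk>pc s = Step7; \<not> idx_k s < m; 0 \<le> t; t \<le> c\<rbrakk> \<Longrightarrow>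
     alg_step G n m W d Cs a b c s t (s\<lparr>pc := Step2, found := insert (cur s) (found s)\<rparr>)"
| step8_next:
    "\<lbrakk>pc s = Step8; idx_i s < length Cs; 0 \<le> t; t \<le> c\<rbrakk> \<Longrightarrow>
     alg_step G n m W d Cs a b c s t
       (s\<lparr>pc := Step2, idx_i := idx_i s + 1, idx_j := 1, seen := {}\<rparr>)"
| step8_halt:
    "\<lbrakk>pc s = Step8; \<not> idx_i s < length Cs; 0 \<le> t; t \<le> c\<rbrakk> \<Longrightarrow>
     alg_step G n m W d Cs a b c s t (s\<lparr>pc := Halted\<rparr>)"

inductive run :: "('s \<Rightarrow> real \<Rightarrow> 's \<Rightarrow> bool) \<Rightarrow> 's \<Rightarrow> real \<Rightarrow> 's \<Rightarrow> bool"
  for step where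
  run_refl: "run step s 0 s"
| run_step: "\<lbrakk>run step s t s'; step s' t' s''\<rbrakk> \<Longrightarrow> run step s (t + t') s''"

text \<open>
  Every execution from \<open>s\<close> halts, without getting stuck before, and its total cost is at most \<open>B\<close>.
\<close>

definition halts_within :: "(state \<Rightarrow> real \<Rightarrow> state \<Rightarrow> bool) \<Rightarrow> state \<Rightarrow> real \<Rightarrow> bool" where
  "halts_within step s B \<longleftrightarrow>
     (\<nexists>r. r 0 = s \<and> (\<forall>l::nat. \<exists>t. step (r l) t (r (Suc l)))) \<and>
     (\<forall>t s'. run step s t s' \<longrightarrow>
        t \<le> B \<and> (pc s' = Halted \<or> (\<exists>t' s''. step s' t' s'')))"

end

theory Submission
  imports Defs
begin

text \<open>
  The cost is bounded by the potential method. Attach to every label \<open>l\<close> a weight \<open>w l \<ge> 0\<close>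
  that bounds the cost of one execution of that step. Testing one arc costs at most
  \<open>w Step5 + w Step6 + w Step7\<close>; processing one candidate costs at most
  \<open>w Step2 + w Step3 + w Step4\<close> plus \<open>m\<close> arc tests; exhausting one minimal cut costs at most
  \<open>\<sigma>\<close> candidates plus one failing \<open>Step2\<close> and one \<open>Step8\<close>. The function \<open>potential\<close> is the
  weight of the worst possible remaining execution counted in this way, and every
  transition lowers it by at least the weight of the step executed.

  This is used for two choices of the weights. With all weights \<open>1\<close>, the potential bounds the number
  of remaining steps, so no execution is infinite. With the weights of the cost conventions,
  it bounds the total cost by
  \<open>c + p (\<sigma> (a n\<^sup>2 sqrt m + c + m (2 c + b m)) + c)\<close>, which is
  \<open>O((m\<^sup>2 + n\<^sup>2 sqrt m) p \<sigma>)\<close> because \<open>m\<close>, \<open>p\<close> and \<open>\<sigma>\<close> are at least \<open>1\<close>. That \<open>p \<ge> 1\<close>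
  holds because the set of all arcs separates the source from the sink and so
  contains a minimal cut.

  An execution could also get stuck, and only \<open>Step6\<close> is critical, since it needs a
  flow of value \<open>d\<close> to send. There \<open>d\<close> is the maximum flow value of the stored vector, a
  flow attains this maximum, and it stays feasible when one capacity grows.
\<close>

section \<open>Executions bounded by potentials\<close>

lemma run_potential_bound:
  fixes \<Phi> :: "'s \<Rightarrow> real"
  assumes "run step s t s'" and "I s"
    and inv: "\<And>s t s'. I s \<Longrightarrow> step s t s' \<Longrightarrow> I s'"
    and cost: "\<And>s t s'. I s \<Longrightarrow> step s t s' \<Longrightarrow> \<Phi> s' + t \<le> \<Phi> s"
  shows "I s' \<and> \<Phi> s' + t \<le> \<Phi> s"
  using assms(1,2)
proof induction
  case run_refl
  then show ?case by simp
next
  case (run_step s t s' t' s'')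
  then have "I s'" "\<Phi> s' + t \<le> \<Phi> s" by blast+
  moreover from this have "I s''" "\<Phi> s'' + t' \<le> \<Phi> s'"
    using run_step.hyps(2) inv cost by blast+
  ultimately show ?case by linarith
qed

text \<open>
  Two potentials are needed because the cost of a step may be \<open>0\<close>: \<open>\<Phi>\<close> pays for the costs, while
  \<open>\<Psi>\<close> counts steps and excludes infinite executions.
\<close>

lemma halts_withinI:
  fixes \<Phi> \<Psi> :: "state \<Rightarrow> real"
  assumes "I s"
    and inv: "\<And>s t s'. I s \<Longrightarrow> step s t s' \<Longrightarrow> I s'"
    and cost: "\<And>s t s'. I s \<Longrightarrow> step s t s' \<Longrightarrow> \<Phi> s' + t \<le> \<Phi> s"
    and count: "\<And>s t s'. I s \<Longrightarrow> step s t s' \<Longrightarrow> \<Psi> s' + 1 \<le> \<Psi> s"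
    and nonneg: "\<And>s. 0 \<le> \<Phi> s" "\<And>s. 0 \<le> \<Psi> s"
    and progress: "\<And>s. I s \<Longrightarrow> pc s \<noteq> Halted \<Longrightarrow> \<exists>t s'. step s t s'"
    and "\<Phi> s \<le> B"
  shows "halts_within step s B"
  unfolding halts_within_def
proof (intro conjI notI allI impI)
  assume "\<exists>r. r 0 = s \<and> (\<forall>l::nat. \<exists>t. step (r l) t (r (Suc l)))"
  then obtain r where r: "r 0 = s" "\<And>l::nat. \<exists>t. step (r l) t (r (Suc l))"
    by blast
  have "I (r l) \<and> \<Psi> (r l) + real l \<le> \<Psi> s" for l
  proof (induction l)
    case 0
    then show ?case using r(1) \<open>I s\<close> by simp
  next
    case (Suc l)
    obtain t where "step (r l) t (r (Suc l))" using r(2) by blast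
    then show ?case using Suc inv count[of "r l" t "r (Suc l)"] by auto
  qed
  then have "real l \<le> \<Psi> s" for l
    using nonneg(2)[of "r l"] by (smt (verit))
  then show False
    using reals_Archimedean2[of "\<Psi> s"] by (meson linorder_not_less)
next
  fix t s' assume "run step s t s'"
  then have "I s' \<and> \<Phi> s' + t \<le> \<Phi> s"
    using \<open>I s\<close> by (rule run_potential_bound) (fact inv, fact cost)
  then have *: "I s'" "\<Phi> s' + t \<le> \<Phi> s" by blast+
  show "t \<le> B" using *(2) nonneg(1)[of s'] \<open>\<Phi> s \<le> B\<close> by linarith
  show "pc s' = Halted \<or> (\<exists>t' s''. step s' t' s'')"
    using progress *(1) by blast
qed

section \<open>Networks, flows and candidates\<close>

lemma limited_flow_network_finite_arcs:
  "limited_flow_network G n m \<Longrightarrow> finite (arcs G)"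
  by (simp add: limited_flow_network_def)

text \<open>
  The set of all arcs is a cut, as source and sink are different nodes; so an inclusion-minimal
  cut exists by finiteness.
\<close>

lemma minimal_cut_exists:
  assumes "limited_flow_network G n m"
  shows "\<exists>C. minimal_cut G n C"
proof -
  have n: "2 \<le> n" using assms by (simp add: limited_flow_network_def)
  have "\<not> pre_digraph.apath (G\<lparr>arcs := arcs G - arcs G\<rparr>) 1 p n" for p
    using n
    by (cases p) (auto simp: pre_digraph.apath_def pre_digraph.awalk_def pre_digraph.cas.simps)
  then have "is_cut G n (arcs G)" by (auto simp: is_cut_def)
  moreover have "finite {C. is_cut G n C}"
    using limited_flow_network_finite_arcs[OF assms]
    by (rule_tac finite_subset[of _ "Pow (arcs G)"]) (auto simp: is_cut_def)
  ultimately obtain C where "is_cut G n C" "\<forall>C'\<in>{C. is_cut G n C}. C' \<subseteq> C \<longrightarrow> C = C'"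
    using finite_has_minimal2[of "{C. is_cut G n C}" "arcs G"] by auto
  then show ?thesis by (auto simp: minimal_cut_def)
qed

lemma finite_candidates:
  assumes "finite (arcs G)"
  shows "finite (candidates G W d C)"
proof -
  have "candidates G W d C \<subseteq> (\<Pi>\<^sub>E e\<in>arcs G. {..W e})"
  proof
    fix X assume X: "X \<in> candidates G W d C"
    then have "X \<in> extensional (arcs G)"
      unfolding candidates_def PiE_iff by blast
    moreover have "X e \<le> W e" if "e \<in> arcs G" for e
      using X that unfolding candidates_def by (cases "e \<in> C") simp_all
    ultimately show "X \<in> (\<Pi>\<^sub>E e\<in>arcs G. {..W e})"
      by (simp add: PiE_iff)
  qed
  then show ?thesis
    using assms by (rule finite_subset[OF _ finite_PiE]) auto
qed

text \<open>
  The values of the flows form a nonempty finite set of integers, because the zero flow exists and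
  every value is bounded by the total capacity. So the maximum that defines \<open>max_flow\<close> is attained.
\<close>

lemma max_flow_attained:
  assumes "finite (arcs G)"
  shows "\<exists>f. is_flow G n X f \<and> flow_value G f = max_flow G n X"
proof -
  let ?V = "{flow_value G f |f. is_flow G n X f}"
  let ?B = "int (sum X (arcs G))"
  have "?V \<subseteq> {- ?B..?B}"
  proof
    fix v assume "v \<in> ?V"
    then obtain f where f: "v = flow_value G f" "is_flow G n X f" by blast
    have bound: "sum f A \<le> sum X (arcs G)" if "A \<subseteq> arcs G" for A
    proof -
      have "sum f A \<le> sum X A"
        using f(2) that by (intro sum_mono) (auto simp: is_flow_def)
      also have "\<dots> \<le> sum X (arcs G)"
        using assms that by (intro sum_mono2) auto
      finally show ?thesis .
    qed
    have "in_arcs G 1 \<subseteq> arcs G" "out_arcs G 1 \<subseteq> arcs G"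
      by (auto simp: in_arcs_def out_arcs_def)
    then have "sum f (in_arcs G 1) \<le> sum X (arcs G)" "sum f (out_arcs G 1) \<le> sum X (arcs G)"
      by (simp_all only: bound)
    then show "v \<in> {- ?B..?B}" unfolding f(1) flow_value_def by (simp del: of_nat_sum)
  qed
  then have "finite ?V" by (rule finite_subset) simp
  moreover have "is_flow G n X (\<lambda>_. 0)" by (simp add: is_flow_def)
  then have "?V \<noteq> {}" by blast
  ultimately have "Max ?V \<in> ?V" by (rule Max_in)
  then show ?thesis by (auto simp: max_flow_def)
qed

lemma is_flow_add_unit: "is_flow G n X f \<Longrightarrow> is_flow G n (add_unit X e) f"
  by (auto simp: is_flow_def add_unit_def intro: trans_le_add1)

section \<open>The potential of a state of the algorithm\<close>

locale minimal_cut_search =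
  fixes G :: "(nat, nat) pre_digraph" and n m :: nat and W :: cap_vec and d :: nat
    and Cs :: "nat set list" and \<sigma> :: nat
  assumes network: "limited_flow_network G n m"
    and cuts_nonempty: "Cs \<noteq> []"
    and candidates_bound: "C \<in> set Cs \<Longrightarrow> card (candidates G W d C) \<le> \<sigma>"
begin

text \<open>
  The range of \<open>idx_i\<close> makes \<open>\<sigma>\<close> bound the candidates of the current cut, the range of \<open>idx_k\<close>
  bounds the remaining arc tests, and the maximum flow value provides the flow sent in \<open>Step6\<close>.
\<close>

definition invariant :: "state \<Rightarrow> bool" where
  "invariant s \<longleftrightarrow>
     (pc s \<noteq> Step1 \<longrightarrow> 1 \<le> idx_i s \<and> idx_i s \<le> length Cs) \<and>
     (pc s = Step4 \<longrightarrow> val s = max_flow G n (cur s)) \<and>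
     (pc s \<in> {Step5, Step6, Step7} \<longrightarrow>
        1 \<le> idx_k s \<and> idx_k s \<le> m \<and> max_flow G n (cur s) = int d)"

lemma invariant_step:
  assumes "invariant s" and "alg_step G n m W d Cs a b c s t s'"
  shows "invariant s'"
proof -
  have m: "1 \<le> m" using network by (simp add: limited_flow_network_def)
  have p: "1 \<le> length Cs" using cuts_nonempty by (simp add: Suc_leI)
  show ?thesis
    using assms(2,1) m p by cases (simp_all add: invariant_def)
qed

lemma step6_flow_exists:
  assumes "invariant s" and "pc s = Step6"
  shows "\<exists>f. is_flow G n (add_unit (cur s) (idx_k s)) f \<and> flow_value G f = int d"
  using assms max_flow_attained[OF limited_flow_network_finite_arcs[OF network], of n "cur s"]
    is_flow_add_unit
  by (fastforce simp: invariant_def)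

lemma progress:
  assumes "invariant s" and "pc s \<noteq> Halted" and "0 \<le> a" and "0 \<le> b" and "0 \<le> c"
  shows "\<exists>t s'. alg_step G n m W d Cs a b c s t s'"
proof -
  have flow_cost: "0 \<le> a * ((real n)\<^sup>2 * sqrt (real m))" and path_cost: "0 \<le> b * real m"
    using assms by simp_all
  show ?thesis
  proof (cases "pc s")
    case Step1
    then show ?thesis using alg_step.step1[of s 0 c] assms by blast
  next
    case Step2
    then show ?thesis
      by (meson alg_step.step2_next alg_step.step2_none subsetI)
  next
    case Step3
    then show ?thesis using alg_step.step3[OF _ order_refl flow_cost] by blast
  next
    case Step4
    then show ?thesis by (meson alg_step.step4_reject alg_step.step4_store order_refl assms(5))
  next
    case Step5
    then show ?thesis by (meson alg_step.step5_saturated alg_step.step5_unsaturated order_refl assms(5))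
  next
    case Step6
    moreover obtain f where
      "is_flow G n (add_unit (cur s) (idx_k s)) f" "flow_value G f = int d"
      using step6_flow_exists[OF assms(1) Step6] by blast
    ultimately show ?thesis
      by (meson alg_step.step6_reject alg_step.step6_pass order_refl path_cost)
  next
    case Step7
    then show ?thesis by (meson alg_step.step7_next alg_step.step7_accept order_refl assms(5))
  next
    case Step8
    then show ?thesis by (meson alg_step.step8_next alg_step.step8_halt order_refl assms(5))
  next
    case Halted
    then show ?thesis using assms by simp
  qed
qed

definition arc_weight :: "(label \<Rightarrow> real) \<Rightarrow> real" where
  "arc_weight w = w Step5 + w Step6 + w Step7"

definition candidate_weight :: "(label \<Rightarrow> real) \<Rightarrow> real" where
  "candidate_weight w = w Step2 + w Step3 + w Step4 + real m * arc_weight w"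

definition cut_weight :: "(label \<Rightarrow> real) \<Rightarrow> real" where
  "cut_weight w = real \<sigma> * candidate_weight w + w Step2 + w Step8"

definition remaining_cuts_weight :: "(label \<Rightarrow> real) \<Rightarrow> state \<Rightarrow> real" where
  "remaining_cuts_weight w s = w Step8 + real (length Cs - idx_i s) * cut_weight w"

text \<open>
  The weight of all that follows once the candidate in hand has been dealt with: the candidates not
  yet seen, the failing \<open>Step2\<close> of the current cut, and the later cuts.
\<close>

definition remaining_search_weight :: "(label \<Rightarrow> real) \<Rightarrow> state \<Rightarrow> real" where
  "remaining_search_weight w s =
     real (card (candidates G W d (Cs ! (idx_i s - 1)) - seen s)) * candidate_weight w
     + w Step2 + remaining_cuts_weight w s"

lemma remaining_search_weight_update [simp]:
  "remaining_search_weight w (s\<lparr>pc := l\<rparr>) = remaining_search_weight w s"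
  "remaining_search_weight w (s\<lparr>idx_j := k\<rparr>) = remaining_search_weight w s"
  "remaining_search_weight w (s\<lparr>idx_k := k\<rparr>) = remaining_search_weight w s"
  "remaining_search_weight w (s\<lparr>cur := X\<rparr>) = remaining_search_weight w s"
  "remaining_search_weight w (s\<lparr>val := v\<rparr>) = remaining_search_weight w s"
  "remaining_search_weight w (s\<lparr>stored := S\<rparr>) = remaining_search_weight w s"
  "remaining_search_weight w (s\<lparr>found := F\<rparr>) = remaining_search_weight w s"
  by (simp_all add: remaining_search_weight_def remaining_cuts_weight_def)

text \<open>
  At \<open>Step5\<close> the arcs \<open>k, ..., m\<close> are still to be tested; at \<open>Step6\<close> and \<open>Step7\<close> the rest of the
  test of arc \<open>k\<close> is listed separately, so that only \<open>m - k\<close> full tests remain.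
\<close>

definition potential :: "(label \<Rightarrow> real) \<Rightarrow> state \<Rightarrow> real" where
  "potential w s =
     (case pc s of
        Step1 \<Rightarrow> w Step1 + real (length Cs) * cut_weight w
      | Step2 \<Rightarrow> remaining_search_weight w s
      | Step3 \<Rightarrow> remaining_search_weight w s + w Step3 + w Step4 + real m * arc_weight w
      | Step4 \<Rightarrow> remaining_search_weight w s + w Step4 + real m * arc_weight w
      | Step5 \<Rightarrow> remaining_search_weight w s + real (m + 1 - idx_k s) * arc_weight w
      | Step6 \<Rightarrow> remaining_search_weight w s + w Step6 + w Step7
                   + real (m - idx_k s) * arc_weight w
      | Step7 \<Rightarrow> remaining_search_weight w s + w Step7 + real (m - idx_k s) * arc_weight w
      | Step8 \<Rightarrow> remaining_cuts_weight w s
      | Halted \<Rightarrow> 0)"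

context
  fixes w :: "label \<Rightarrow> real"
  assumes w_nonneg: "\<And>l. 0 \<le> w l"
begin

lemma arc_weight_nonneg: "0 \<le> arc_weight w"
  by (simp add: arc_weight_def w_nonneg)

lemma candidate_weight_nonneg: "0 \<le> candidate_weight w"
  by (simp add: candidate_weight_def w_nonneg arc_weight_nonneg)

lemma cut_weight_nonneg: "0 \<le> cut_weight w"
  by (simp add: cut_weight_def w_nonneg candidate_weight_nonneg)

lemma remaining_cuts_weight_nonneg: "0 \<le> remaining_cuts_weight w s"
  by (simp add: remaining_cuts_weight_def w_nonneg cut_weight_nonneg)

lemma remaining_search_weight_nonneg: "0 \<le> remaining_search_weight w s"
  by (simp add: remaining_search_weight_def w_nonneg candidate_weight_nonneg
      remaining_cuts_weight_nonneg)

lemma potential_nonneg: "0 \<le> potential w s"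
  by (auto simp: potential_def w_nonneg cut_weight_nonneg arc_weight_nonneg
      remaining_cuts_weight_nonneg remaining_search_weight_nonneg split: label.split)

lemma candidates_weight_le:
  assumes "1 \<le> i" and "i \<le> length Cs"
  shows "real (card (candidates G W d (Cs ! (i - 1)))) * candidate_weight w
         \<le> real \<sigma> * candidate_weight w"
proof -
  have "Cs ! (i - 1) \<in> set Cs" using assms by (intro nth_mem) linarith
  then show ?thesis
    by (intro mult_right_mono candidate_weight_nonneg) (simp add: candidates_bound)
qed

text \<open>
  Entering a cut releases its share \<open>cut_weight w\<close>, which covers the search for all of its
  candidates.
\<close>

lemma remaining_search_weight_fresh_le:
  assumes "1 \<le> idx_i s" and "idx_i s \<le> length Cs" and "seen s = {}"
  shows "remaining_search_weight w s \<le> real (Suc (length Cs - idx_i s)) * cut_weight w"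
  using candidates_weight_le[OF assms(1,2)] assms(3)
  by (simp add: remaining_search_weight_def remaining_cuts_weight_def cut_weight_def
      distrib_right)

text \<open>
  A newly generated solution releases one \<open>candidate_weight w\<close>, which pays for its processing.
\<close>

lemma remaining_search_weight_insert:
  assumes "X \<in> candidates G W d (Cs ! (idx_i s - 1))" and "X \<notin> seen s"
    and "idx_i s' = idx_i s" and "seen s' = insert X (seen s)"
  shows "remaining_search_weight w s' + candidate_weight w = remaining_search_weight w s"
proof -
  let ?U = "candidates G W d (Cs ! (idx_i s - 1)) - seen s"
  have "finite ?U"
    using finite_candidates[OF limited_flow_network_finite_arcs[OF network]] by simp
  moreover have "X \<in> ?U" using assms by simp
  ultimately have "card ?U = Suc (card (?U - {X}))" by (rule card.remove)
  moreover have "candidates G W d (Cs ! (idx_i s - 1)) - insert X (seen s) = ?U - {X}"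
    by blast
  ultimately show ?thesis
    using assms(3,4)
    by (simp add: remaining_search_weight_def remaining_cuts_weight_def distrib_right)
qed

lemma potential_step:
  assumes "invariant s" and "alg_step G n m W d Cs a b c s t s'"
  shows "potential w s' + w (pc s) \<le> potential w s"
  using assms(2)
proof cases
  case step1
  then show ?thesis
    using remaining_search_weight_fresh_le[of s'] cuts_nonempty
    by (simp add: potential_def Suc_leI)
next
  case (step2_next X)
  then show ?thesis
    using remaining_search_weight_insert[of X s s']
    by (simp add: potential_def candidate_weight_def)
next
  case step2_none
  then show ?thesis
    by (simp add: potential_def remaining_search_weight_def remaining_cuts_weight_def
        candidate_weight_nonneg)
next
  case step3
  then show ?thesis
    by (simp add: potential_def)
next
  case step4_reject
  then show ?thesis
    by (simp add: potential_def arc_weight_nonneg)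
next
  case step4_store
  then show ?thesis
    by (simp add: potential_def)
next
  case step5_saturated
  then have "m + 1 - idx_k s = Suc (m - idx_k s)"
    using assms(1) by (auto simp: invariant_def)
  then show ?thesis
    using step5_saturated w_nonneg[of Step6]
    by (simp add: potential_def distrib_right
        arc_weight_def[of w])
next
  case step5_unsaturated
  then have "m + 1 - idx_k s = Suc (m - idx_k s)"
    using assms(1) by (auto simp: invariant_def)
  then show ?thesis
    using step5_unsaturated
    by (simp add: potential_def distrib_right
        arc_weight_def[of w])
next
  case step6_reject
  then show ?thesis
    using w_nonneg[of Step7]
    by (simp add: potential_def arc_weight_nonneg)
next
  case step6_pass
  then show ?thesis
    by (simp add: potential_def)
next
  case step7_next
  then show ?thesis
    by (simp add: potential_def)
next
  case step7_accept
  then show ?thesis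
    by (simp add: potential_def arc_weight_nonneg)
next
  case step8_next
  then have "Suc (length Cs - idx_i s') = length Cs - idx_i s" by simp
  then show ?thesis
    using step8_next remaining_search_weight_fresh_le[of s']
    by (simp add: potential_def remaining_cuts_weight_def)
next
  case step8_halt
  then show ?thesis
    by (simp add: potential_def remaining_cuts_weight_def cut_weight_nonneg)
qed

end

section \<open>The complexity bound\<close>

definition step_cost :: "real \<Rightarrow> real \<Rightarrow> real \<Rightarrow> label \<Rightarrow> real" where
  "step_cost a b c l =
     (case l of Step2 \<Rightarrow> 0 | Step3 \<Rightarrow> a * ((real n)\<^sup>2 * sqrt (real m)) | Step6 \<Rightarrow> b * real m
      | _ \<Rightarrow> c)"

lemma alg_step_cost_le: "alg_step G n m W d Cs a b c s t s' \<Longrightarrow> t \<le> step_cost a b c (pc s)"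
  by (erule alg_step.cases) (auto simp: step_cost_def)

lemma halts_within_potential:
  assumes "0 \<le> a" and "0 \<le> b" and "0 \<le> c" and "pc s = Step1"
  shows "halts_within (alg_step G n m W d Cs a b c) s (potential (step_cost a b c) s)"
proof (rule halts_withinI[where I = invariant and \<Phi> = "potential (step_cost a b c)"
      and \<Psi> = "potential (\<lambda>_. 1)"])
  have nonneg: "0 \<le> step_cost a b c l" for l
    using assms by (auto simp: step_cost_def split: label.split)
  show "0 \<le> potential (step_cost a b c) s" "0 \<le> potential (\<lambda>_. 1) s" for s
    by (simp_all add: potential_nonneg nonneg)
  show "potential (step_cost a b c) s' + t \<le> potential (step_cost a b c) s"
    if "invariant s" "alg_step G n m W d Cs a b c s t s'" for s t s'
    using potential_step[of "step_cost a b c", OF nonneg that] alg_step_cost_le[OF that(2)] by linarith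
  show "potential (\<lambda>_. 1) s' + 1 \<le> potential (\<lambda>_. 1) s"
    if "invariant s" "alg_step G n m W d Cs a b c s t s'" for s t s'
    using potential_step[OF _ that, of "\<lambda>_. 1"] by simp
  show "invariant s'" if "invariant s" "alg_step G n m W d Cs a b c s t s'" for s t s'
    using invariant_step that .
  show "\<exists>t s'. alg_step G n m W d Cs a b c s t s'" if "invariant s" "pc s \<noteq> Halted" for s
    using progress that assms(1-3) .
qed (use assms in \<open>simp_all add: invariant_def\<close>)

text \<open>
  Since \<open>m\<close>, \<open>\<sigma>\<close> and the number of cuts are at least \<open>1\<close>, the constant costs per run, per cut, per
  candidate and per arc test are all absorbed into \<open>m\<^sup>2\<close> per candidate; this makes the
  five copies of \<open>c\<close> in the constant (one per run, per cut and per candidate, two per arc test). The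
  summand \<open>1\<close> keeps the constant positive when \<open>a\<close>, \<open>b\<close> and \<open>c\<close> all vanish.
\<close>

lemma initial_potential_le:
  assumes "0 \<le> a" and "0 \<le> b" and "0 \<le> c" and "1 \<le> \<sigma>" and "pc s = Step1"
  shows "potential (step_cost a b c) s
         \<le> (a + b + 5 * c + 1) *
           (((real m)\<^sup>2 + (real n)\<^sup>2 * sqrt (real m)) * real (length Cs) * real \<sigma>)"
proof -
  define M where "M = (real m)\<^sup>2"
  define N where "N = (real n)\<^sup>2 * sqrt (real m)"
  define q where "q = real (length Cs) * real \<sigma>"
  have p: "1 \<le> real (length Cs)" using cuts_nonempty by (simp add: Suc_leI)
  have m: "1 \<le> real m" using network by (simp add: limited_flow_network_def)
  have M: "1 \<le> M" "real m \<le> M"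
    using m by (simp_all add: M_def power2_eq_square mult_ge1_I)
  have N: "0 \<le> N" by (simp add: N_def)
  have pq: "real (length Cs) \<le> q"
    using mult_left_mono[of 1 "real \<sigma>" "real (length Cs)"] \<open>1 \<le> \<sigma>\<close> by (simp add: q_def)
  then have q: "1 \<le> q" using p by linarith
  have "potential (step_cost a b c) s
        = c + q * (a * N + c + 2 * c * real m + b * M) + real (length Cs) * c"
    using assms(5)
    by (simp add: potential_def cut_weight_def candidate_weight_def arc_weight_def step_cost_def
        q_def M_def N_def power2_eq_square algebra_simps)
  also have "\<dots> \<le> c * (q * M) + q * (a * N + c * M + 2 * c * M + b * M) + c * (q * M)"
  proof (intro add_mono mult_left_mono)
    have "q \<le> q * M" using q M by simp
    then have "1 \<le> q * M" "real (length Cs) \<le> q * M" using q pq by linarith+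
    then show "c \<le> c * (q * M)" "real (length Cs) * c \<le> c * (q * M)"
      using \<open>0 \<le> c\<close> by (simp_all add: mult_le_cancel_left1 mult.commute mult_left_mono)
  qed (use M q assms in \<open>auto simp: mult_le_cancel_left1\<close>)
  also have "\<dots> = q * (a * N + (b + 5 * c) * M)" by (simp add: algebra_simps)
  also have "\<dots> \<le> q * ((a + b + 5 * c + 1) * (M + N))"
  proof (rule mult_left_mono)
    have "(a + b + 5 * c + 1) * (M + N)
          = a * N + (b + 5 * c) * M + ((a + 1) * M + (b + 5 * c + 1) * N)"
      by (simp add: algebra_simps)
    moreover have "0 \<le> (a + 1) * M + (b + 5 * c + 1) * N" using M N assms by simp
    ultimately show "a * N + (b + 5 * c) * M \<le> (a + b + 5 * c + 1) * (M + N)" by linarith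
  qed (use q in simp)
  finally show ?thesis by (simp add: q_def M_def N_def mult_ac)
qed

end

theorem theorem2:
  fixes a b c :: real
  assumes "0 \<le> a" and "0 \<le> b" and "0 \<le> c"
  shows "\<exists>K>0. \<forall>(G :: (nat, nat) pre_digraph) (n :: nat) (m :: nat) (W :: nat \<Rightarrow> nat) (d :: nat)
           (Cs :: nat set list) (p :: nat) (\<sigma> :: nat) (s :: state).
           limited_flow_network G n m \<longrightarrow>
           0 < d \<longrightarrow>
           lists_minimal_cuts G n Cs \<longrightarrow>
           p = length Cs \<longrightarrow>
           1 \<le> \<sigma> \<longrightarrow>
           (\<forall>C\<in>set Cs. card (candidates G W d C) \<le> \<sigma>) \<longrightarrow>
           is_initial s \<longrightarrow>
           halts_within (alg_step G n m W d Cs a b c) s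
             (K * (((real m)\<^sup>2 + (real n)\<^sup>2 * sqrt (real m)) * real p * real \<sigma>))"
proof (intro exI[of _ "a + b + 5 * c + 1"] conjI allI impI)
  show "0 < a + b + 5 * c + 1" using assms by simp
  fix G :: "(nat, nat) pre_digraph" and n m :: nat and W :: "nat \<Rightarrow> nat" and d :: nat
    and Cs :: "nat set list" and p \<sigma> :: nat and s :: state
  assume network: "limited_flow_network G n m" and cuts: "lists_minimal_cuts G n Cs"
    and p: "p = length Cs" and \<sigma>: "1 \<le> \<sigma>"
    and bound: "\<forall>C\<in>set Cs. card (candidates G W d C) \<le> \<sigma>" and init: "is_initial s"
  have "Cs \<noteq> []"
    using minimal_cut_exists[OF network] cuts by (auto simp: lists_minimal_cuts_def)
  then interpret minimal_cut_search G n m W d Cs \<sigma>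
    using network bound by unfold_locales auto
  have "pc s = Step1" using init by (simp add: is_initial_def)
  from halts_within_potential[OF assms this] initial_potential_le[OF assms \<sigma> this]
  show "halts_within (alg_step G n m W d Cs a b c) s
          ((a + b + 5 * c + 1) *
           (((real m)\<^sup>2 + (real n)\<^sup>2 * sqrt (real m)) * real p * real \<sigma>))"
    unfolding halts_within_def p by (meson order_trans)
qed

end
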